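(* Let $n_1,\ldots,n_6$ be positive integers such that $n_1 \geq \cdots \geq n_6$. Then the complete $6$-partite graph $K_{n_1,n_2,\ldots,n_6}$ is competitively orientable if and only if one of the following holds: (a) $n_1\geq 5$ and $n_2=1$; (b) $n_1 \geq 3$, $n_2 \geq 2$, and $n_3=1$; (c) $n_3\geq 2$.
   Context: All graphs are finite and simple. An orientation of a graph $G$ is a digraph $D$ on the vertex set $V(G)$ with no loops, no multiple arcs and no directed $2$-cycles, whose underlying graph (with edge set $\{uv \mid (u,v)\in A(D)\}$) is $G$. A digraph $D$ is competitive if every pair of distinct vertices $x,y$ has a common out-neighbor, i.e. there is a vertex $z$ with $(x,z),(y,z)\in A(D)$. A graph is competitively orientable if it has a competitive orientation. $K_{n_1,\ldots,n_k}$ denotes the complete $k$-partite graph with partite sets of sizes $n_1,\ldots,n_k$. *)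

theory Defs
  imports "Graph_Theory.Pair_Digraph" "Graph_Theory.Digraph_Component"
begin

text \<open>
  As usual in Graph_Theory, a finite simple undirected graph is a symmetric digraph
  (locale \<^locale>\<open>pair_graph\<close>): an edge uv is the pair of arcs (u, v) and (v, u).
  A \<^locale>\<open>pair_digraph\<close> is finite and loop-free, and its arcs are pairs of vertices,
  so that it has no multiple arcs. The underlying graph of a digraph is its
  symmetrisation \<^const>\<open>mk_symmetric\<close>.
\<close>

definition orientation :: "'a pair_pre_digraph \<Rightarrow> 'a pair_pre_digraph \<Rightarrow> bool" where
  "orientation G D \<longleftrightarrow>
     pair_digraph D \<and>
     (\<forall>u v. (u, v) \<in> parcs D \<longrightarrow> (v, u) \<notin> parcs D) \<and>
     mk_symmetric (with_proj D) = G"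

definition competitive :: "'a pair_pre_digraph \<Rightarrow> bool" where
  "competitive D \<longleftrightarrow>
     (\<forall>x \<in> pverts D. \<forall>y \<in> pverts D. x \<noteq> y \<longrightarrow>
        (\<exists>z \<in> pverts D. (x, z) \<in> parcs D \<and> (y, z) \<in> parcs D))"

definition competitively_orientable :: "'a pair_pre_digraph \<Rightarrow> bool" where
  "competitively_orientable G \<longleftrightarrow> (\<exists>D. orientation G D \<and> competitive D)"

text \<open>The vertex (i, j) is the j-th element of the i-th partite set, counting from 0.\<close>

definition complete_multipartite :: "nat list \<Rightarrow> (nat \<times> nat) pair_pre_digraph" where
  "complete_multipartite ns =
     (let V = (SIGMA i:{..<length ns}. {..<ns ! i})
      in \<lparr> pverts = V, parcs = {(u, v). u \<in> V \<and> v \<in> V \<and> fst u \<noteq> fst v} \<rparr>)"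

lemma pair_graph_complete_multipartite: "pair_graph (complete_multipartite ns)"
proof -
  let ?V = "SIGMA i:{..<length ns}. {..<ns ! i}"
  have "finite {(u, v). u \<in> ?V \<and> v \<in> ?V \<and> fst u \<noteq> fst v}"
    by (rule finite_subset[of _ "?V \<times> ?V"]) auto
  then show ?thesis
    by unfold_locales
      (auto simp: complete_multipartite_def Let_def symmetric_def intro!: symI)
qed

end

theory Submission
  imports Defs
begin

text \<open>
  Enlarging a partite set preserves competitive orientability: a new vertex can copy the
  neighbourhoods of an old one in its partite set. Hence everything reduces to the minimal
  orientable graphs, for which orientations found by computer search are given, and to the maximal
  non-orientable ones, \<open>K\<^bsub>4,1,1,1,1,1\<^esub>\<close> and \<open>K\<^bsub>2,2,1,1,1,1\<^esub>\<close>. For the latter, competitiveness is a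
  propositional formula with one atom per edge (30 and 26 atoms), refuted by resolution.
\<close>

section \<open>Orientations of a complete multipartite graph as binary predicates\<close>

definition mp_verts :: "nat list \<Rightarrow> (nat \<times> nat) set" where
  "mp_verts ns = (SIGMA i:{..<length ns}. {..<ns ! i})"

lemma mem_parcs_mk_symmetric:
  "(u, v) \<in> parcs (mk_symmetric (with_proj D)) \<longleftrightarrow> (u, v) \<in> parcs D \<or> (v, u) \<in> parcs D"
proof -
  have "(u, v) \<in> parcs (mk_symmetric (with_proj D)) \<longleftrightarrow>
      (\<exists>e\<in>parcs D. (u, v) = (fst e, snd e) \<or> (u, v) = (snd e, fst e))"
    by (simp add: parcs_mk_symmetric)
  also have "\<dots> \<longleftrightarrow> (u, v) \<in> parcs D \<or> (v, u) \<in> parcs D"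
    by (metis fst_conv prod.collapse snd_conv)
  finally show ?thesis .
qed

text \<open>
  Only the values of \<^term>\<open>A\<close> between different partite sets matter. The orientation condition
  is stated for \<^prop>\<open>fst u < fst v\<close> so that on a concrete graph it serves as a terminating rewrite
  rule, leaving one propositional atom per edge.
\<close>

definition competitive_rel :: "nat list \<Rightarrow> (nat \<times> nat \<Rightarrow> nat \<times> nat \<Rightarrow> bool) \<Rightarrow> bool" where
  "competitive_rel ns A \<longleftrightarrow>
     (\<forall>u\<in>mp_verts ns. \<forall>v\<in>mp_verts ns. fst u < fst v \<longrightarrow> (A v u \<longleftrightarrow> \<not> A u v)) \<and>
     (\<forall>x\<in>mp_verts ns. \<forall>y\<in>mp_verts ns. x \<noteq> y \<longrightarrow>
        (\<exists>z\<in>mp_verts ns. fst z \<noteq> fst x \<and> fst z \<noteq> fst y \<and> A x z \<and> A y z))"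

text \<open>Frees the orientation condition from the order of the parts, by exchanging
  \<open>u\<close> and \<open>v\<close> when \<open>v\<close> lies in the earlier part.\<close>

lemma competitive_rel_tournament:
  assumes "competitive_rel ns A" "u \<in> mp_verts ns" "v \<in> mp_verts ns" "fst u \<noteq> fst v"
  shows "A v u \<longleftrightarrow> \<not> A u v"
proof (cases "fst u < fst v")
  case True
  then show ?thesis using assms(1-3) unfolding competitive_rel_def by blast
next
  case False
  with assms(4) have "fst v < fst u" by simp
  then have "A u v \<longleftrightarrow> \<not> A v u"
    using assms(1-3) unfolding competitive_rel_def by blast
  then show ?thesis by blast
qed

lemma competitive_rel_competition:
  assumes "competitive_rel ns A" "x \<in> mp_verts ns" "y \<in> mp_verts ns" "x \<noteq> y"
  shows "\<exists>z\<in>mp_verts ns. fst z \<noteq> fst x \<and> fst z \<noteq> fst y \<and> A x z \<and> A y z"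
  using assms unfolding competitive_rel_def by blast

text \<open>Membership in \<open>parcs D\<close> serves as \<open>A\<close> in one direction; in the
  other, \<open>A\<close> is cut down to a digraph. From here on only predicates on pairs are
  handled.\<close>

lemma competitively_orientable_iff:
  "competitively_orientable (complete_multipartite ns) \<longleftrightarrow> (\<exists>A. competitive_rel ns A)"
    (is "?L \<longleftrightarrow> ?R")
proof
  let ?V = "mp_verts ns"
  let ?K = "complete_multipartite ns"
  assume ?L
  then obtain D where asym: "\<And>u v. (u, v) \<in> parcs D \<Longrightarrow> (v, u) \<notin> parcs D"
    and sym: "mk_symmetric (with_proj D) = ?K" and comp: "competitive D"
    by (auto simp: competitively_orientable_def orientation_def)
  have verts: "pverts D = ?V"
    using arg_cong[OF sym, of pverts]
    by (simp add: complete_multipartite_def mp_verts_def Let_def)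
  have arcs: "(u, v) \<in> parcs D \<or> (v, u) \<in> parcs D \<longleftrightarrow> u \<in> ?V \<and> v \<in> ?V \<and> fst u \<noteq> fst v" for u v
    unfolding mem_parcs_mk_symmetric[symmetric] sym
    by (simp add: complete_multipartite_def mp_verts_def Let_def)
  have "competitive_rel ns (\<lambda>u v. (u, v) \<in> parcs D)"
    unfolding competitive_rel_def
  proof (intro conjI ballI impI)
    fix u v assume "u \<in> ?V" "v \<in> ?V" "fst u < fst v"
    then show "(v, u) \<in> parcs D \<longleftrightarrow> (u, v) \<notin> parcs D"
      using arcs[of u v] asym[of u v] by (metis less_imp_neq)
  next
    fix x y assume "x \<in> ?V" "y \<in> ?V" "x \<noteq> y"
    then obtain z where "z \<in> ?V" "(x, z) \<in> parcs D" "(y, z) \<in> parcs D"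
      using comp verts unfolding competitive_def by blast
    moreover from this have "fst z \<noteq> fst x" "fst z \<noteq> fst y"
      using arcs[of x z] arcs[of y z] by auto
    ultimately show "\<exists>z\<in>?V. fst z \<noteq> fst x \<and> fst z \<noteq> fst y \<and> (x, z) \<in> parcs D \<and> (y, z) \<in> parcs D"
      by blast
  qed
  then show ?R by blast
next
  let ?V = "mp_verts ns"
  assume ?R
  then obtain A where A: "competitive_rel ns A" ..
  \<comment> \<open>\<open>A\<close> is arbitrary outside \<open>?V\<close> and within a partite
    set, so \<open>D\<close> keeps only the pairs that are edges.\<close>
  define D where "D = \<lparr>pverts = ?V, parcs = {(u, v). u \<in> ?V \<and> v \<in> ?V \<and> fst u \<noteq> fst v \<and> A u v}\<rparr>"
  have D: "(u, v) \<in> parcs D \<longleftrightarrow> u \<in> ?V \<and> v \<in> ?V \<and> fst u \<noteq> fst v \<and> A u v" for u v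
    by (simp add: D_def)
  have verts: "pverts D = ?V" by (simp add: D_def)
  have "finite ?V" by (simp add: mp_verts_def)
  then have "finite (parcs D)"
    by (auto simp: D_def intro: rev_finite_subset[of "?V \<times> ?V"])
  with \<open>finite ?V\<close> have "pair_digraph D"
    by unfold_locales (auto simp: D_def)
  moreover have "(v, u) \<notin> parcs D" if "(u, v) \<in> parcs D" for u v
    using that competitive_rel_tournament[OF A, of u v] unfolding D by metis
  moreover have "mk_symmetric (with_proj D) = complete_multipartite ns"
  proof -
    have "(u, v) \<in> parcs (mk_symmetric (with_proj D)) \<longleftrightarrow> u \<in> ?V \<and> v \<in> ?V \<and> fst u \<noteq> fst v" for u v
      unfolding mem_parcs_mk_symmetric D using competitive_rel_tournament[OF A, of u v] by metis
    then have "parcs (mk_symmetric (with_proj D)) = parcs (complete_multipartite ns)"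
      by (auto simp: set_eq_iff complete_multipartite_def mp_verts_def Let_def)
    moreover have "pverts (mk_symmetric (with_proj D)) = pverts (complete_multipartite ns)"
      by (simp add: D_def complete_multipartite_def mp_verts_def Let_def)
    ultimately show ?thesis by (simp add: pair_pre_digraph.equality)
  qed
  moreover have "competitive D"
    unfolding competitive_def
  proof (intro ballI impI)
    fix x y assume xy: "x \<in> pverts D" "y \<in> pverts D" "x \<noteq> y"
    then obtain z where "z \<in> ?V" "fst z \<noteq> fst x" "fst z \<noteq> fst y" "A x z" "A y z"
      using competitive_rel_competition[OF A, of x y] verts by metis
    with xy show "\<exists>z\<in>pverts D. (x, z) \<in> parcs D \<and> (y, z) \<in> parcs D"
      unfolding verts D by metis
  qed
  ultimately show ?L
    unfolding competitively_orientable_def orientation_def by blast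
qed

section \<open>Enlarging partite sets\<close>

text \<open>The orientation is pulled back along a part-preserving retraction \<open>c\<close> of
  the larger vertex set onto the smaller. Nonempty parts give \<open>c\<close> its targets; a second
  part gives two copies of one vertex a common out-neighbor.\<close>

lemma competitively_orientable_mono:
  assumes le: "list_all2 (\<lambda>m n. 1 \<le> m \<and> m \<le> n) ms ns" and len: "2 \<le> length ms"
    and orientable: "competitively_orientable (complete_multipartite ms)"
  shows "competitively_orientable (complete_multipartite ns)"
proof -
  let ?V = "mp_verts ms" and ?W = "mp_verts ns"
  obtain A where A: "competitive_rel ms A"
    using orientable unfolding competitively_orientable_iff ..
  \<comment> \<open>Vertices beyond the old size of part \<open>i\<close> all become copies of its
    last old vertex, which has index \<open>ms ! i - 1\<close>.\<close>
  define c where "c = (\<lambda>(i, j). (i, min j (ms ! i - 1)))"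
  have bounds: "length ms = length ns" "\<And>i. i < length ns \<Longrightarrow> 0 < ms ! i \<and> ms ! i \<le> ns ! i"
    using le by (force simp: list_all2_conv_all_nth)+
  have fst_c: "fst (c u) = fst u" for u
    by (simp add: c_def split: prod.split)
  have c_in: "c u \<in> ?V" if "u \<in> ?W" for u
    using that bounds by (fastforce simp: c_def mp_verts_def)
  have V_W: "z \<in> ?W" if "z \<in> ?V" for z
    using that bounds by (fastforce simp: mp_verts_def)
  have c_id: "c z = z" if "z \<in> ?V" for z
    using that by (auto simp: c_def mp_verts_def)
  have comp: "\<exists>z\<in>?W. fst z \<noteq> fst x \<and> fst z \<noteq> fst y \<and> A (c x) (c z) \<and> A (c y) (c z)"
    if "x \<in> ?W" "y \<in> ?W" for x y
  proof -
    have "\<exists>z\<in>?V. fst z \<noteq> fst (c x) \<and> fst z \<noteq> fst (c y) \<and> A (c x) z \<and> A (c y) z"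
    proof (cases "c x = c y")
      case True
      \<comment> \<open>Copies of one vertex need just an out-neighbor of it. Pairing
        \<open>c x\<close> with the vertex \<open>(i, 0)\<close> of another part yields one.\<close>
      obtain i where i: "i < length ns" "i \<noteq> fst (c x)"
      proof (cases "fst (c x) = 0")
        case True
        then show ?thesis using that[of 1] len bounds(1) by simp
      next
        case False
        then show ?thesis using that[of 0] len bounds(1) by force
      qed
      then have "(i, 0) \<in> ?V" using bounds by (simp add: mp_verts_def)
      then show ?thesis using competitive_rel_competition[OF A, of "c x" "(i, 0)"] c_in[OF that(1)] i(2) True by force
    next
      case False
      then show ?thesis using competitive_rel_competition[OF A, of "c x" "c y"] c_in that by blast
    qed
    \<comment> \<open>The common out-neighbor lies in \<open>?V\<close>, where \<open>c\<close> is
      the identity, so it also serves in \<open>?W\<close>.\<close>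
    then show ?thesis using V_W c_id fst_c by metis
  qed
  have tour: "A (c v) (c u) \<longleftrightarrow> \<not> A (c u) (c v)"
    if "u \<in> ?W" "v \<in> ?W" "fst u \<noteq> fst v" for u v
    using competitive_rel_tournament[OF A c_in c_in] that fst_c by metis
  have "competitive_rel ns (\<lambda>u v. A (c u) (c v))"
    unfolding competitive_rel_def
  proof (intro conjI ballI impI)
    fix u v assume "u \<in> ?W" "v \<in> ?W" "fst u < fst v"
    then show "A (c v) (c u) \<longleftrightarrow> \<not> A (c u) (c v)"
      by (intro tour less_imp_neq)
  next
    fix x y assume "x \<in> ?W" "y \<in> ?W"
    then show "\<exists>z\<in>?W. fst z \<noteq> fst x \<and> fst z \<noteq> fst y \<and> A (c x) (c z) \<and> A (c y) (c z)"
      by (rule comp)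
  qed
  then show ?thesis
    unfolding competitively_orientable_iff by blast
qed

section \<open>Minimal orientable graphs\<close>

lemma orientable_K511111:
  "competitively_orientable (complete_multipartite [5, 1, 1, 1, 1, 1])"
proof -
  \<comment> \<open>This table has fivefold symmetry. With indices modulo 5, singleton
    \<open>i\<close> beats \<open>i-1\<close> and \<open>i-2\<close>, and the out-sets of the large
    part are the rotations of {2, 3, 5}. Any two of these meet, each meets every consecutive pair,
    and their complements are exactly the pairs \<open>i\<close>, \<open>i+2\<close> that share no
    out-neighbor among the singletons.\<close>
  let ?outs = "map_of
     [((0, 0), [(2, 0), (3, 0), (5, 0)]),
      ((0, 1), [(1, 0), (2, 0), (4, 0)]),
      ((0, 2), [(1, 0), (3, 0), (4, 0)]),
      ((0, 3), [(2, 0), (4, 0), (5, 0)]),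
      ((0, 4), [(1, 0), (3, 0), (5, 0)]),
      ((1, 0), [(0, 0), (0, 3), (4, 0), (5, 0)]),
      ((2, 0), [(0, 2), (0, 4), (1, 0), (5, 0)]),
      ((3, 0), [(0, 1), (0, 3), (1, 0), (2, 0)]),
      ((4, 0), [(0, 0), (0, 4), (2, 0), (3, 0)]),
      ((5, 0), [(0, 1), (0, 2), (3, 0), (4, 0)])]"
  \<comment> \<open>Every vertex is a key of the table, so \<open>the\<close> never meets
    \<open>None\<close>; evaluation settles the bounded quantifiers.\<close>
  have "competitive_rel [5, 1, 1, 1, 1, 1] (\<lambda>u v. v \<in> set (the (?outs u)))"
    by code_simp
  then show ?thesis
    unfolding competitively_orientable_iff by blast
qed

lemma orientable_K321111:
  "competitively_orientable (complete_multipartite [3, 2, 1, 1, 1, 1])"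
proof -
  let ?outs = "map_of
     [((0, 0), [(1, 1), (2, 0), (3, 0)]),
      ((0, 1), [(1, 0), (2, 0), (5, 0)]),
      ((0, 2), [(1, 0), (3, 0), (4, 0), (5, 0)]),
      ((1, 0), [(0, 0), (3, 0), (5, 0)]),
      ((1, 1), [(0, 1), (0, 2), (2, 0), (5, 0)]),
      ((2, 0), [(0, 2), (1, 0), (3, 0), (4, 0)]),
      ((3, 0), [(0, 1), (1, 1), (4, 0), (5, 0)]),
      ((4, 0), [(0, 0), (0, 1), (1, 0), (1, 1)]),
      ((5, 0), [(0, 0), (2, 0), (4, 0)])]"
  have "competitive_rel [3, 2, 1, 1, 1, 1] (\<lambda>u v. v \<in> set (the (?outs u)))"
    by code_simp
  then show ?thesis
    unfolding competitively_orientable_iff by blast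
qed

lemma orientable_K222111:
  "competitively_orientable (complete_multipartite [2, 2, 2, 1, 1, 1])"
proof -
  let ?outs = "map_of
     [((0, 0), [(1, 1), (2, 1), (3, 0), (4, 0)]),
      ((0, 1), [(1, 1), (2, 0), (5, 0)]),
      ((1, 0), [(0, 0), (0, 1), (3, 0), (5, 0)]),
      ((1, 1), [(2, 0), (3, 0), (4, 0)]),
      ((2, 0), [(0, 0), (1, 0), (3, 0), (5, 0)]),
      ((2, 1), [(0, 1), (1, 0), (1, 1), (3, 0)]),
      ((3, 0), [(0, 1), (4, 0), (5, 0)]),
      ((4, 0), [(0, 1), (1, 0), (2, 0), (2, 1)]),
      ((5, 0), [(0, 0), (1, 1), (2, 1), (4, 0)])]"
  have "competitive_rel [2, 2, 2, 1, 1, 1] (\<lambda>u v. v \<in> set (the (?outs u)))"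
    by code_simp
  then show ?thesis
    unfolding competitively_orientable_iff by blast
qed

section \<open>Maximal non-orientable graphs\<close>

lemma not_orientable_K411111:
  "\<not> competitively_orientable (complete_multipartite [4, 1, 1, 1, 1, 1])"
proof
  assume "competitively_orientable (complete_multipartite [4, 1, 1, 1, 1, 1])"
  then obtain A where A: "competitive_rel [4, 1, 1, 1, 1, 1] A"
    unfolding competitively_orientable_iff ..
  have V: "mp_verts [4, 1, 1, 1, 1, 1] =
      {(0, 0), (0, 1), (0, 2), (0, 3), (1, 0), (2, 0), (3, 0), (4, 0), (5, 0)}"
    by code_simp
  note edges = A[unfolded competitive_rel_def V, THEN conjunct1, simplified]
  \<comment> \<open>Rewriting with \<open>edges\<close> turns each backward arc into a negated
    forward one, so the competition conditions alone carry the whole constraint.\<close>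
  note pairs = A[unfolded competitive_rel_def V, THEN conjunct2, simplified, simplified edges]
  from pairs show False by satx
qed

lemma not_orientable_K221111:
  "\<not> competitively_orientable (complete_multipartite [2, 2, 1, 1, 1, 1])"
proof
  assume "competitively_orientable (complete_multipartite [2, 2, 1, 1, 1, 1])"
  then obtain A where A: "competitive_rel [2, 2, 1, 1, 1, 1] A"
    unfolding competitively_orientable_iff ..
  have V: "mp_verts [2, 2, 1, 1, 1, 1] =
      {(0, 0), (0, 1), (1, 0), (1, 1), (2, 0), (3, 0), (4, 0), (5, 0)}"
    by code_simp
  note edges = A[unfolded competitive_rel_def V, THEN conjunct1, simplified]
  note pairs = A[unfolded competitive_rel_def V, THEN conjunct2, simplified, simplified edges]
  from pairs show False by satx
qed

theorem theorem1:
  fixes n1 n2 n3 n4 n5 n6 :: nat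
  assumes "n1 \<ge> 1" and "n2 \<ge> 1" and "n3 \<ge> 1" and "n4 \<ge> 1" and "n5 \<ge> 1" and "n6 \<ge> 1"
    and "n1 \<ge> n2" and "n2 \<ge> n3" and "n3 \<ge> n4" and "n4 \<ge> n5" and "n5 \<ge> n6"
  shows "competitively_orientable (complete_multipartite [n1, n2, n3, n4, n5, n6]) \<longleftrightarrow>
           (n1 \<ge> 5 \<and> n2 = 1) \<or>
           (n1 \<ge> 3 \<and> n2 \<ge> 2 \<and> n3 = 1) \<or>
           n3 \<ge> 2"
    (is "competitively_orientable ?K \<longleftrightarrow> ?R")
proof
  assume K: "competitively_orientable ?K"
  show ?R
  proof (rule ccontr)
    assume R: "\<not> ?R"
    then have ones: "n3 = 1" "n4 = 1" "n5 = 1" "n6 = 1"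
      using assms by linarith+
    consider "n2 = 1" "n1 \<le> 4" | "n1 = 2" "n2 = 2"
      using R ones(1) assms by linarith
    then show False
    proof cases
      case 1
      \<comment> \<open>Here \<open>?K\<close> lies componentwise below the sizes 4, 1, 1, 1, 1, 1,
        so its orientability would pass up to that graph.\<close>
      then have "competitively_orientable (complete_multipartite [4, 1, 1, 1, 1, 1])"
        using competitively_orientable_mono[OF _ _ K] ones assms(1) by simp
      then show False using not_orientable_K411111 by contradiction
    next
      case 2
      then show False using K ones not_orientable_K221111 by simp
    qed
  qed
next
  assume ?R
  \<comment> \<open>Each case is the region componentwise above one of the three minimal graphs, the
    sizes being nonincreasing.\<close>
  then consider "n1 \<ge> 5" | "n1 \<ge> 3" "n2 \<ge> 2" | "n3 \<ge> 2"
    by blast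
  then show "competitively_orientable ?K"
  proof cases
    case 1
    then show ?thesis
      using competitively_orientable_mono[OF _ _ orientable_K511111] assms by simp
  next
    case 2
    then show ?thesis
      using competitively_orientable_mono[OF _ _ orientable_K321111] assms by simp
  next
    case 3
    then show ?thesis
      using competitively_orientable_mono[OF _ _ orientable_K222111] assms by simp
  qed
qed

end
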